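(* Let $a,b\in\mathbb{N}$ and let $(M,\mathcal{D},g)$ be the sub-Riemannian manifold determined by $a$, $b$ and $\alpha$, with $\alpha\equiv 1$. Let $\gamma:(-1,1)\to M$, $\gamma(t):=(0,t,0)$. If $b>4a+4$, then the curve $\gamma$ is not locally geodesic.
   Context: Notation: $\mathbb{N}=\{1,2,3,\dots\}$. Let $M:=(-\tfrac12,\tfrac12)\times(-1,1)\times\mathbb{R}\subset\mathbb{R}^3$ with coordinates $x=(x_1,x_2,x_3)$. For $b\in\mathbb{N}$ define the vector fields on $M$ $$X_1(x):=\partial_1,\qquad X_2(x):=\partial_2+x_1^2x_2^b\,\partial_3,$$ and the distribution $\mathcal{D}:=\mathrm{span}\{X_1,X_2\}$. For $a\in\mathbb{N}$ and $\alpha\in C^\infty((-1,1),[0,1])$ let $g$ be the Riemannian metric on $\mathcal{D}$ given by $$g_x(X_1,X_1)=1,\quad g_x(X_1,X_2)=0,\quad g_x(X_2,X_2)=1-\alpha(x_2)\,x_1x_2^a,\qquad x\in M.$$ An absolutely continuous curve $\eta:I\to M$ on an interval $I$ is horizontal if $\dot\eta(t)\in\mathcal{D}_{\eta(t)}$ for almost every $t\in I$. Its length, for $\eta:[0,1]\to M$, is $L(\eta):=\int_0^1 g_{\eta(t)}(\dot\eta(t),\dot\eta(t))^{1/2}\,dt$. The sub-Riemannian distance on $M$ is $d(x,y):=\inf\{L(\eta)\mid \eta:[0,1]\to M\text{ horizontal},\ \eta(0)=x,\ \eta(1)=y\}$. A curve $\eta:I\to M$ is a geodesic if it is an isometric embedding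 of $I$ into $(M,d)$, i.e. $d(\eta(s),\eta(t))=|s-t|$ for all $s,t\in I$. A curve $\eta:I\to M$ is locally geodesic if every $t\in I$ has a neighborhood $J\subseteq I$ (an interval, relatively open in $I$) such that $\eta|_J$ is a geodesic. *)

theory Defs
  imports "HOL-Analysis.Analysis"
begin

definition sr_manifold :: "(real^3) set" where
  "sr_manifold = {x. -1/2 < x$1 \<and> x$1 < 1/2 \<and> -1 < x$2 \<and> x$2 < 1}"

definition X1 :: "real^3 \<Rightarrow> real^3" where
  "X1 x = vector [1, 0, 0]"

definition X2 :: "nat \<Rightarrow> real^3 \<Rightarrow> real^3" where
  "X2 b x = vector [0, 1, (x$1)^2 * (x$2)^b]"

definition distribution :: "nat \<Rightarrow> real^3 \<Rightarrow> (real^3) set" where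
  "distribution b x = span {X1 x, X2 b x}"

text \<open>A vector \<open>v\<close> in the distribution at \<open>x\<close> equals \<open>v$1 *\<^sub>R X1 x + v$2 *\<^sub>R X2 b x\<close>, so a
  bilinear form on the distribution is an expression in the first two components of its arguments,
  and \<open>b\<close> does not occur in it. The values are meaningful only for arguments in the distribution;
  see \<open>sr_metric_frame\<close> and \<open>distribution_frame\<close>.\<close>

definition sr_metric :: "nat \<Rightarrow> (real \<Rightarrow> real) \<Rightarrow> real^3 \<Rightarrow> real^3 \<Rightarrow> real^3 \<Rightarrow> real" where
  "sr_metric a \<alpha> x v w = v$1 * w$1 + (1 - \<alpha> (x$2) * x$1 * (x$2)^a) * (v$2 * w$2)"

lemma distribution_frame:
  "v \<in> distribution b x \<longleftrightarrow> v = v$1 *\<^sub>R X1 x + v$2 *\<^sub>R X2 b x"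
proof
  assume "v \<in> distribution b x"
  then obtain p q where "v = p *\<^sub>R X1 x + q *\<^sub>R X2 b x"
    unfolding distribution_def span_insert[of "X1 x"] span_singleton
    by (auto simp: algebra_simps)
  then show "v = v$1 *\<^sub>R X1 x + v$2 *\<^sub>R X2 b x"
    by (simp add: X1_def X2_def)
next
  assume *: "v = v$1 *\<^sub>R X1 x + v$2 *\<^sub>R X2 b x"
  show "v \<in> distribution b x"
    unfolding distribution_def by (subst *) (intro span_add span_mul span_base, auto)
qed

lemma sr_metric_frame:
  "sr_metric a \<alpha> x (X1 x) (X1 x) = 1"
  "sr_metric a \<alpha> x (X1 x) (X2 b x) = 0"
  "sr_metric a \<alpha> x (X2 b x) (X1 x) = 0"
  "sr_metric a \<alpha> x (X2 b x) (X2 b x) = 1 - \<alpha> (x$2) * x$1 * (x$2)^a"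
  by (simp_all add: sr_metric_def X1_def X2_def)

lemma bilinear_sr_metric: "bilinear (sr_metric a \<alpha> x)"
  unfolding bilinear_def sr_metric_def by (auto intro!: linearI simp: algebra_simps)

text \<open>The usual \<open>\<epsilon>\<close>-\<open>\<delta>\<close> definition: a \<open>division_of\<close> is a finite family of nonempty compact
  intervals with pairwise disjoint interiors.\<close>

definition absolutely_continuous_on :: "real set \<Rightarrow> (real \<Rightarrow> 'a::real_normed_vector) \<Rightarrow> bool" where
  "absolutely_continuous_on I \<eta> \<longleftrightarrow>
     (\<forall>\<epsilon>>0. \<exists>\<delta>>0. \<forall>\<P> S. \<P> division_of S \<and> S \<subseteq> I \<and> (\<Sum>K\<in>\<P>. Sup K - Inf K) < \<delta> \<longrightarrow>
        (\<Sum>K\<in>\<P>. norm (\<eta> (Sup K) - \<eta> (Inf K))) < \<epsilon>)"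

definition horizontal_on :: "nat \<Rightarrow> real set \<Rightarrow> (real \<Rightarrow> real^3) \<Rightarrow> bool" where
  "horizontal_on b I \<eta> \<longleftrightarrow>
     \<eta> ` I \<subseteq> sr_manifold \<and> absolutely_continuous_on I \<eta> \<and>
     (AE t in lebesgue. t \<in> I \<longrightarrow>
        \<eta> differentiable (at t within I) \<and>
        vector_derivative \<eta> (at t within I) \<in> distribution b (\<eta> t))"

definition sr_length :: "nat \<Rightarrow> (real \<Rightarrow> real) \<Rightarrow> (real \<Rightarrow> real^3) \<Rightarrow> ennreal" where
  "sr_length a \<alpha> \<eta> =
     (\<integral>\<^sup>+t\<in>{0..1}. ennreal (sqrt (sr_metric a \<alpha> (\<eta> t)
        (vector_derivative \<eta> (at t within {0..1})) (vector_derivative \<eta> (at t within {0..1}))))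
      \<partial>lebesgue)"

definition sr_dist :: "nat \<Rightarrow> nat \<Rightarrow> (real \<Rightarrow> real) \<Rightarrow> real^3 \<Rightarrow> real^3 \<Rightarrow> ennreal" where
  "sr_dist a b \<alpha> x y = Inf {sr_length a \<alpha> \<eta> | \<eta>. horizontal_on b {0..1} \<eta> \<and> \<eta> 0 = x \<and> \<eta> 1 = y}"

definition geodesic_on :: "nat \<Rightarrow> nat \<Rightarrow> (real \<Rightarrow> real) \<Rightarrow> real set \<Rightarrow> (real \<Rightarrow> real^3) \<Rightarrow> bool" where
  "geodesic_on a b \<alpha> I \<eta> \<longleftrightarrow>
     \<eta> ` I \<subseteq> sr_manifold \<and> (\<forall>s\<in>I. \<forall>t\<in>I. sr_dist a b \<alpha> (\<eta> s) (\<eta> t) = ennreal \<bar>s - t\<bar>)"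

definition locally_geodesic_on :: "nat \<Rightarrow> nat \<Rightarrow> (real \<Rightarrow> real) \<Rightarrow> real set \<Rightarrow> (real \<Rightarrow> real^3) \<Rightarrow> bool" where
  "locally_geodesic_on a b \<alpha> I \<eta> \<longleftrightarrow>
     (\<forall>t\<in>I. \<exists>J. t \<in> J \<and> is_interval J \<and> openin (top_of_set I) J \<and> geodesic_on a b \<alpha> J \<eta>)"

end

theory Submission
  imports Defs
begin

text \<open>
  A horizontal curve is determined by its projection to the \<open>(x\<^sub>1, x\<^sub>2)\<close>-plane and its initial
  height: along it, \<open>x\<^sub>3\<close> grows by the integral of \<open>x\<^sub>1\<^sup>2 x\<^sub>2\<^sup>b dx\<^sub>2\<close>, and its length is the length of
  the projection for the metric \<open>dx\<^sub>1\<^sup>2 + (1 - x\<^sub>1 x\<^sub>2\<^sup>a) dx\<^sub>2\<^sup>2\<close>. This metric makes it profitable to move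
  up along the \<open>x\<^sub>2\<close>-axis slightly to its right, at the price of a height that has to be cancelled
  before the end point is reached. The curve \<open>\<gamma>\<close> fails to be locally geodesic at \<open>t = 0\<close> because
  the profit can be made close to \<open>0\<close>, where the height gained is tiny (the factor \<open>x\<^sub>2\<^sup>b\<close>), while the
  height is cancelled at a fixed distance \<open>r\<close> from \<open>0\<close>, where \<open>x\<^sub>2\<^sup>b\<close> is of order \<open>1\<close>.

  Quantitatively, fix a small \<open>r > 0\<close> and let \<open>\<epsilon>\<close> tend to \<open>0\<close>. The bump with projection
  \<open>(0, 0) \<rightarrow> (h, \<epsilon>) \<rightarrow> (h, 2\<epsilon>) \<rightarrow> (0, 3\<epsilon>)\<close> gains about \<open>\<epsilon> h \<epsilon>\<^sup>a / 2\<close> on its plateau and loses about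
  \<open>h\<^sup>2 / \<epsilon>\<close> on its slopes. With \<open>h = \<epsilon>\<^bsup>a+2\<^esup> / 4\<close> this is a net gain of order \<open>\<epsilon>\<^bsup>2a+3\<^esup>\<close>, and the
  height gained is at most of order \<open>\<epsilon> h\<^sup>2 \<epsilon>\<^sup>b\<close>, which is \<open>\<epsilon>\<^bsup>2a+b+5\<^esup>\<close> (\<open>reach_bump\<close>). A rectangular loop
  at \<open>(0, r)\<close> with sides \<open>w\<close> along \<open>x\<^sub>1\<close> and \<open>k\<close> along \<open>x\<^sub>2\<close>, run through in the right direction, costs
  \<open>2 w + 2 k\<close> and lowers \<open>x\<^sub>3\<close> by about \<open>w\<^sup>2 k r\<^sup>b\<close> (\<open>reach_loop\<close>). Let \<open>k\<close> be a small multiple of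
  \<open>\<epsilon>\<^bsup>2a+3\<^esup>\<close>. To cancel the height of the bump, \<open>w\<^sup>2\<close> then has to be of order \<open>\<epsilon>\<^bsup>b+2\<^esup>\<close>, so that \<open>w\<close> is
  negligible against \<open>\<epsilon>\<^bsup>2a+3\<^esup>\<close> exactly when \<open>b + 2 > 4 a + 6\<close>. In this case bump, straight segment
  and loop together join the origin to \<open>(0, r, 0)\<close> with length less than \<open>r\<close> (\<open>reach_shortcut\<close>).
\<close>

section \<open>Lipschitz curves and vector-valued calculus\<close>

lemma vector_3_eq_axis:
  "(vector [x, y, z] :: real^3) = x *\<^sub>R axis 1 1 + y *\<^sub>R axis 2 1 + z *\<^sub>R axis 3 1"
  by (simp add: vec_eq_iff forall_3 axis_def)

lemma has_vector_derivative_vector_3: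
  assumes "(f has_real_derivative f') (at u within S)" "(g has_real_derivative g') (at u within S)"
    and "(h has_real_derivative h') (at u within S)"
  shows "((\<lambda>u. vector [f u, g u, h u] :: real^3) has_vector_derivative vector [f', g', h'])
    (at u within S)"
  unfolding vector_3_eq_axis
  by (intro has_vector_derivative_add has_vector_derivative_scaleR[THEN has_vector_derivative_eq_rhs]
      assms) (auto intro!: derivative_eq_intros assms)

lemma continuous_on_vector_3:
  fixes f g h :: "real \<Rightarrow> real"
  assumes "continuous_on S f" "continuous_on S g" "continuous_on S h"
  shows "continuous_on S (\<lambda>u. vector [f u, g u, h u] :: real^3)"
  unfolding vector_3_eq_axis by (intro continuous_intros assms)

lemma lipschitz_imp_absolutely_continuous_on:
  fixes \<eta> :: "real \<Rightarrow> 'a::real_normed_vector"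
  assumes "C-lipschitz_on I \<eta>"
  shows "absolutely_continuous_on I \<eta>"
  unfolding absolutely_continuous_on_def
proof (intro allI impI)
  fix \<epsilon> :: real assume "\<epsilon> > 0"
  have C: "C \<ge> 0" using assms by (rule lipschitz_on_nonneg)
  have "(\<Sum>K\<in>\<P>. norm (\<eta> (Sup K) - \<eta> (Inf K))) < \<epsilon>"
    if P: "\<P> division_of S" "S \<subseteq> I" and small: "(\<Sum>K\<in>\<P>. Sup K - Inf K) < \<epsilon> / (C + 1)" for \<P> S
  proof -
    have "norm (\<eta> (Sup K) - \<eta> (Inf K)) \<le> C * (Sup K - Inf K)" if KP: "K \<in> \<P>" for K
    proof -
      obtain p q where K: "K = {p..q}" "p \<le> q"
        using division_ofD(3)[OF P(1) KP] division_ofD(4)[OF P(1) KP]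
        by (metis atLeastatMost_empty_iff box_real(2))
      moreover have "K \<subseteq> I" using division_ofD(2)[OF P(1) KP] P(2) by blast
      ultimately have "p \<in> I" "q \<in> I" by auto
      from lipschitz_on_normD[OF assms this(2,1)] K show ?thesis by simp
    qed
    then have "(\<Sum>K\<in>\<P>. norm (\<eta> (Sup K) - \<eta> (Inf K))) \<le> C * (\<Sum>K\<in>\<P>. Sup K - Inf K)"
      unfolding sum_distrib_left by (rule sum_mono)
    also have "\<dots> \<le> C * (\<epsilon> / (C + 1))"
      using C small by (intro mult_left_mono) auto
    also have "\<dots> < \<epsilon>" using C \<open>\<epsilon> > 0\<close> by (simp add: field_simps)
    finally show ?thesis .
  qed
  then show "\<exists>\<delta>>0. \<forall>\<P> S. \<P> division_of S \<and> S \<subseteq> I \<and> (\<Sum>K\<in>\<P>. Sup K - Inf K) < \<delta> \<longrightarrow>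
        (\<Sum>K\<in>\<P>. norm (\<eta> (Sup K) - \<eta> (Inf K))) < \<epsilon>"
    using C \<open>\<epsilon> > 0\<close> by (intro exI[of _ "\<epsilon> / (C + 1)"]) auto
qed

section \<open>Concatenation of piecewise smooth horizontal curves\<close>

text \<open>The number \<open>l\<close> is only an upper bound for the length of \<open>\<eta>\<close>, given as the integral of a bound
  \<open>\<sigma>\<close> for the speed. The bound is integrated in place of the speed itself because it is
  piecewise constant in all applications. The finite exceptional set \<open>F\<close> collects the corners.\<close>

definition sr_path ::
  "nat \<Rightarrow> nat \<Rightarrow> (real \<Rightarrow> real) \<Rightarrow> real \<Rightarrow> real \<Rightarrow> (real \<Rightarrow> real^3) \<Rightarrow> real \<Rightarrow> bool" where
  "sr_path a b \<alpha> s t \<eta> l \<longleftrightarrow>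
     \<eta> ` {s..t} \<subseteq> sr_manifold \<and> (\<exists>C. C-lipschitz_on {s..t} \<eta>) \<and>
     (\<exists>\<sigma> F. finite F \<and> (\<sigma> has_integral l) {s..t} \<and> (\<forall>u\<in>{s..t}. 0 \<le> \<sigma> u) \<and>
        (\<forall>u\<in>{s<..<t} - F. \<exists>v. (\<eta> has_vector_derivative v) (at u) \<and>
            v \<in> distribution b (\<eta> u) \<and> sqrt (sr_metric a \<alpha> (\<eta> u) v v) \<le> \<sigma> u))"

text \<open>Length does not depend on the parametrization. Asking for a curve on every parameter interval
  encodes this, so that curves can be concatenated without being reparametrized.\<close>

definition joinable :: "nat \<Rightarrow> nat \<Rightarrow> (real \<Rightarrow> real) \<Rightarrow> real^3 \<Rightarrow> real^3 \<Rightarrow> real \<Rightarrow> bool" where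
  "joinable a b \<alpha> x y l \<longleftrightarrow>
     (\<forall>s t. s < t \<longrightarrow> (\<exists>\<eta>. sr_path a b \<alpha> s t \<eta> l \<and> \<eta> s = x \<and> \<eta> t = y))"

lemma sr_path_concat:
  assumes 1: "sr_path a b \<alpha> s m \<eta>\<^sub>1 l\<^sub>1" and 2: "sr_path a b \<alpha> m t \<eta>\<^sub>2 l\<^sub>2"
    and eq: "\<eta>\<^sub>1 m = \<eta>\<^sub>2 m" and le: "s \<le> m" "m \<le> t"
  shows "sr_path a b \<alpha> s t (\<lambda>u. if u \<le> m then \<eta>\<^sub>1 u else \<eta>\<^sub>2 u) (l\<^sub>1 + l\<^sub>2)"
proof -
  let ?\<eta> = "\<lambda>u. if u \<le> m then \<eta>\<^sub>1 u else \<eta>\<^sub>2 u"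
  obtain C\<^sub>1 \<sigma>\<^sub>1 F\<^sub>1 where C1: "C\<^sub>1-lipschitz_on {s..m} \<eta>\<^sub>1" and F1: "finite F\<^sub>1"
    and \<sigma>1: "(\<sigma>\<^sub>1 has_integral l\<^sub>1) {s..m}" "\<And>u. u \<in> {s..m} \<Longrightarrow> 0 \<le> \<sigma>\<^sub>1 u"
    and d1: "\<And>u. u \<in> {s<..<m} - F\<^sub>1 \<Longrightarrow> \<exists>v. (\<eta>\<^sub>1 has_vector_derivative v) (at u) \<and>
            v \<in> distribution b (\<eta>\<^sub>1 u) \<and> sqrt (sr_metric a \<alpha> (\<eta>\<^sub>1 u) v v) \<le> \<sigma>\<^sub>1 u"
    using 1 unfolding sr_path_def by blast
  obtain C\<^sub>2 \<sigma>\<^sub>2 F\<^sub>2 where C2: "C\<^sub>2-lipschitz_on {m..t} \<eta>\<^sub>2" and F2: "finite F\<^sub>2"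
    and \<sigma>2: "(\<sigma>\<^sub>2 has_integral l\<^sub>2) {m..t}" "\<And>u. u \<in> {m..t} \<Longrightarrow> 0 \<le> \<sigma>\<^sub>2 u"
    and d2: "\<And>u. u \<in> {m<..<t} - F\<^sub>2 \<Longrightarrow> \<exists>v. (\<eta>\<^sub>2 has_vector_derivative v) (at u) \<and>
            v \<in> distribution b (\<eta>\<^sub>2 u) \<and> sqrt (sr_metric a \<alpha> (\<eta>\<^sub>2 u) v v) \<le> \<sigma>\<^sub>2 u"
    using 2 unfolding sr_path_def by blast
  let ?\<sigma> = "\<lambda>u. if u \<le> m then \<sigma>\<^sub>1 u else \<sigma>\<^sub>2 u"
  have "(?\<sigma> has_integral l\<^sub>1) {s..m}"
    by (rule has_integral_spike_finite[OF _ _ \<sigma>1(1), of "{}"]) auto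
  moreover have "(?\<sigma> has_integral l\<^sub>2) {m..t}"
    by (rule has_integral_spike_finite[OF _ _ \<sigma>2(1), of "{m}"]) auto
  ultimately have \<sigma>: "(?\<sigma> has_integral (l\<^sub>1 + l\<^sub>2)) {s..t}"
    using has_integral_combine le by blast
  have "\<exists>v. (?\<eta> has_vector_derivative v) (at u) \<and>
            v \<in> distribution b (?\<eta> u) \<and> sqrt (sr_metric a \<alpha> (?\<eta> u) v v) \<le> ?\<sigma> u"
    if u: "u \<in> {s<..<t} - (insert m (F\<^sub>1 \<union> F\<^sub>2))" for u
  proof (cases "u < m")
    case True
    then obtain v where v: "(\<eta>\<^sub>1 has_vector_derivative v) (at u)" "v \<in> distribution b (\<eta>\<^sub>1 u)"
      "sqrt (sr_metric a \<alpha> (\<eta>\<^sub>1 u) v v) \<le> \<sigma>\<^sub>1 u"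
      using d1[of u] u by auto
    have "(?\<eta> has_vector_derivative v) (at u)"
      by (rule has_vector_derivative_transform_within_open[OF v(1), of "{..<m}"]) (use True in auto)
    then show ?thesis using v True by auto
  next
    case False
    then have "m < u" using u by auto
    then obtain v where v: "(\<eta>\<^sub>2 has_vector_derivative v) (at u)" "v \<in> distribution b (\<eta>\<^sub>2 u)"
      "sqrt (sr_metric a \<alpha> (\<eta>\<^sub>2 u) v v) \<le> \<sigma>\<^sub>2 u"
      using d2[of u] u by auto
    have "(?\<eta> has_vector_derivative v) (at u)"
      by (rule has_vector_derivative_transform_within_open[OF v(1), of "{m<..}"])
        (use \<open>m < u\<close> in auto)
    then show ?thesis using v \<open>m < u\<close> by auto
  qed
  moreover have "?\<eta> ` {s..t} \<subseteq> sr_manifold"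
    using 1 2 unfolding sr_path_def by (auto simp: image_subset_iff)
  moreover have "\<forall>u\<in>{s..t}. 0 \<le> ?\<sigma> u" using \<sigma>1(2) \<sigma>2(2) by auto
  ultimately show ?thesis
    unfolding sr_path_def using lipschitz_on_concat_max[OF C1 C2 eq] \<sigma> F1 F2
    by (intro conjI exI[of _ ?\<sigma>] exI[of _ "insert m (F\<^sub>1 \<union> F\<^sub>2)"]) blast+
qed

text \<open>The triangle inequality: each of the two curves is run through in one half of the parameter
  interval.\<close>

lemma joinable_trans [trans]:
  assumes "joinable a b \<alpha> x y l\<^sub>1" "joinable a b \<alpha> y z l\<^sub>2"
  shows "joinable a b \<alpha> x z (l\<^sub>1 + l\<^sub>2)"
  unfolding joinable_def
proof (intro allI impI)
  fix s t :: real assume "s < t"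
  define m where "m = (s + t) / 2"
  have m: "s < m" "m < t" using \<open>s < t\<close> by (auto simp: m_def)
  obtain \<eta>\<^sub>1 where 1: "sr_path a b \<alpha> s m \<eta>\<^sub>1 l\<^sub>1" "\<eta>\<^sub>1 s = x" "\<eta>\<^sub>1 m = y"
    using assms(1) m unfolding joinable_def by blast
  obtain \<eta>\<^sub>2 where 2: "sr_path a b \<alpha> m t \<eta>\<^sub>2 l\<^sub>2" "\<eta>\<^sub>2 m = y" "\<eta>\<^sub>2 t = z"
    using assms(2) m unfolding joinable_def by blast
  show "\<exists>\<eta>. sr_path a b \<alpha> s t \<eta> (l\<^sub>1 + l\<^sub>2) \<and> \<eta> s = x \<and> \<eta> t = z"
    using sr_path_concat[OF 1(1) 2(1)] 1 2 m
    by (intro exI[of _ "\<lambda>u. if u \<le> m then \<eta>\<^sub>1 u else \<eta>\<^sub>2 u"]) auto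
qed

text \<open>The corners and the two end points form a null set, and away from them the derivative within
  \<open>{0..1}\<close> is the two-sided derivative bounded by \<open>\<sigma>\<close>.\<close>

lemma sr_dist_le_joinable:
  assumes "joinable a b \<alpha> x y l"
  shows "sr_dist a b \<alpha> x y \<le> ennreal l"
proof -
  obtain \<eta> where \<eta>: "sr_path a b \<alpha> 0 1 \<eta> l" "\<eta> 0 = x" "\<eta> 1 = y"
    using assms unfolding joinable_def by (metis zero_less_one)
  obtain C \<sigma> F where C: "C-lipschitz_on {0..1} \<eta>" and F: "finite F"
    and \<sigma>: "(\<sigma> has_integral l) {0..1}" "\<And>u. u \<in> {0..1} \<Longrightarrow> 0 \<le> \<sigma> u"
    and d: "\<And>u. u \<in> {0<..<1} - F \<Longrightarrow> \<exists>v. (\<eta> has_vector_derivative v) (at u) \<and>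
            v \<in> distribution b (\<eta> u) \<and> sqrt (sr_metric a \<alpha> (\<eta> u) v v) \<le> \<sigma> u"
    using \<eta>(1) unfolding sr_path_def by blast
  let ?v = "\<lambda>u. vector_derivative \<eta> (at u within {0..1})"
  have v: "\<eta> differentiable (at u within {0..1})" "?v u \<in> distribution b (\<eta> u)"
    "sqrt (sr_metric a \<alpha> (\<eta> u) (?v u) (?v u)) \<le> \<sigma> u" if u: "u \<in> {0<..<1} - F" for u
  proof -
    obtain v where v: "(\<eta> has_vector_derivative v) (at u)" "v \<in> distribution b (\<eta> u)"
      "sqrt (sr_metric a \<alpha> (\<eta> u) v v) \<le> \<sigma> u"
      using d[OF u] by blast
    have w: "(\<eta> has_vector_derivative v) (at u within {0..1})"
      using v(1) by (rule has_vector_derivative_at_within)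
    then have "?v u = v"
      using u by (intro vector_derivative_within_closed_interval) auto
    then show "\<eta> differentiable (at u within {0..1})" "?v u \<in> distribution b (\<eta> u)"
      "sqrt (sr_metric a \<alpha> (\<eta> u) (?v u) (?v u)) \<le> \<sigma> u"
      using v w differentiableI_vector by auto
  qed
  have fin: "finite (insert 0 (insert 1 F))" using F by simp
  then have "insert 0 (insert 1 F) \<in> null_sets lebesgue"
    using negligible_finite negligible_iff_null_sets by blast
  then have AE: "AE u in lebesgue. u \<notin> insert 0 (insert 1 F)"
    by (rule AE_not_in)
  have "horizontal_on b {0..1} \<eta>"
    unfolding horizontal_on_def
  proof (intro conjI)
    show "\<eta> ` {0..1} \<subseteq> sr_manifold" using \<eta>(1) by (simp add: sr_path_def)
    show "absolutely_continuous_on {0..1} \<eta>"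
      using C by (rule lipschitz_imp_absolutely_continuous_on)
    show "AE u in lebesgue. u \<in> {0..1} \<longrightarrow> \<eta> differentiable (at u within {0..1}) \<and>
        ?v u \<in> distribution b (\<eta> u)"
      using AE by eventually_elim (use v in auto)
  qed
  then have "sr_dist a b \<alpha> x y \<le> sr_length a \<alpha> \<eta>"
    unfolding sr_dist_def using \<eta> by (intro Inf_lower) blast
  also have "\<dots> \<le> (\<integral>\<^sup>+u. ennreal (\<sigma> u) * indicator {0..1} u \<partial>lebesgue)"
    unfolding sr_length_def
  proof (rule nn_integral_mono_AE)
    show "AE u in lebesgue. ennreal (sqrt (sr_metric a \<alpha> (\<eta> u) (?v u) (?v u))) * indicator {0..1} u
        \<le> ennreal (\<sigma> u) * indicator {0..1} u"
      using AE by eventually_elim (use v(3) in \<open>auto simp: indicator_def intro!: ennreal_leI\<close>)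
  qed
  also have "\<dots> = ennreal l"
    unfolding nn_integral_completion using nn_integral_has_integral_lebesgue'[OF \<sigma>(2,1)] by simp
  finally show ?thesis .
qed

section \<open>Horizontal lifts of planar segments\<close>

lemma interpolation_in_convex:
  fixes p q :: real
  assumes "convex S" "p \<in> S" "q \<in> S" "\<tau> \<in> {0..1}"
  shows "p + \<tau> * (q - p) \<in> S"
proof -
  have "(1 - \<tau>) *\<^sub>R p + \<tau> *\<^sub>R q \<in> S"
    using assms by (intro convexD_alt) auto
  then show ?thesis by (simp add: algebra_simps)
qed

text \<open>The line integral of \<open>x\<^sub>1\<^sup>2 x\<^sub>2\<^sup>b dx\<^sub>2\<close> along the planar segment from \<open>(p\<^sub>1, p\<^sub>2)\<close> to \<open>(q\<^sub>1, q\<^sub>2)\<close>,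
  which is the change of \<open>x\<^sub>3\<close> along a horizontal lift of the segment.\<close>

definition drift :: "nat \<Rightarrow> real \<Rightarrow> real \<Rightarrow> real \<Rightarrow> real \<Rightarrow> real" where
  "drift b p\<^sub>1 p\<^sub>2 q\<^sub>1 q\<^sub>2 =
     (q\<^sub>2 - p\<^sub>2) * integral {0..1} (\<lambda>\<tau>. (p\<^sub>1 + \<tau> * (q\<^sub>1 - p\<^sub>1))\<^sup>2 * (p\<^sub>2 + \<tau> * (q\<^sub>2 - p\<^sub>2)) ^ b)"

text \<open>The third component of the lift is a primitive of the drift integrand. The lift is \<open>C\<^sup>1\<close> on a
  compact interval and hence Lipschitz. With constant planar velocity, a bound \<open>l\<close> for the speed over
  unit time is a bound for the length.\<close>

lemma joinable_segment:
  fixes p\<^sub>1 p\<^sub>2 q\<^sub>1 q\<^sub>2 z :: real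
  assumes box: "p\<^sub>1 \<in> {-1/2<..<1/2}" "q\<^sub>1 \<in> {-1/2<..<1/2}" "p\<^sub>2 \<in> {-1<..<1}" "q\<^sub>2 \<in> {-1<..<1}"
    and speed: "\<And>\<tau>. \<tau> \<in> {0..1} \<Longrightarrow> (q\<^sub>1 - p\<^sub>1)\<^sup>2 + (1 - \<alpha> (p\<^sub>2 + \<tau> * (q\<^sub>2 - p\<^sub>2)) *
        (p\<^sub>1 + \<tau> * (q\<^sub>1 - p\<^sub>1)) * (p\<^sub>2 + \<tau> * (q\<^sub>2 - p\<^sub>2)) ^ a) * (q\<^sub>2 - p\<^sub>2)\<^sup>2 \<le> l\<^sup>2"
    and l: "l \<ge> 0"
  shows "joinable a b \<alpha> (vector [p\<^sub>1, p\<^sub>2, z]) (vector [q\<^sub>1, q\<^sub>2, z + drift b p\<^sub>1 p\<^sub>2 q\<^sub>1 q\<^sub>2]) l"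
  unfolding joinable_def
proof (intro allI impI)
  fix s t :: real assume st: "s < t"
  define x where "x = (\<lambda>\<tau>. p\<^sub>1 + \<tau> * (q\<^sub>1 - p\<^sub>1))"
  define y where "y = (\<lambda>\<tau>. p\<^sub>2 + \<tau> * (q\<^sub>2 - p\<^sub>2))"
  define f where "f = (\<lambda>\<tau>. (q\<^sub>2 - p\<^sub>2) * ((x \<tau>)\<^sup>2 * y \<tau> ^ b))"
  have contf: "continuous_on S f" for S
    unfolding f_def x_def y_def by (intro continuous_intros)
  \<comment> \<open>The primitive is taken on a larger interval to have two-sided derivatives at \<open>0\<close> and \<open>1\<close>.\<close>
  obtain G where G: "\<And>\<tau>. \<tau> \<in> {-1..2} \<Longrightarrow> (G has_vector_derivative f \<tau>) (at \<tau> within {-1..2})"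
    using antiderivative_continuous[OF contf] by blast
  have G': "(G has_real_derivative f \<tau>) (at \<tau>)" if "\<tau> \<in> {0..1}" for \<tau>
    using G[of \<tau>] that by (auto simp: has_real_derivative_iff_has_vector_derivative at_within_Icc_at)
  have "(f has_integral (G 1 - G 0)) {0..1}"
    by (intro fundamental_theorem_of_calculus)
      (auto simp flip: has_real_derivative_iff_has_vector_derivative
        intro!: has_field_derivative_at_within[OF G'])
  then have G1: "G 1 - G 0 = drift b p\<^sub>1 p\<^sub>2 q\<^sub>1 q\<^sub>2"
    by (simp add: drift_def f_def x_def y_def has_integral_iff)
  define \<tau> where "\<tau> = (\<lambda>u. (u - s) / (t - s))"
  have \<tau>: "\<tau> u \<in> {0..1}" if "u \<in> {s..t}" for u
    using that st by (auto simp: \<tau>_def)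
  define \<eta> :: "real \<Rightarrow> real^3" where
    "\<eta> = (\<lambda>u. vector [x (\<tau> u), y (\<tau> u), z + (G (\<tau> u) - G 0)])"
  define v :: "real \<Rightarrow> real^3" where
    "v = (\<lambda>u. vector [(q\<^sub>1 - p\<^sub>1) / (t - s), (q\<^sub>2 - p\<^sub>2) / (t - s), f (\<tau> u) / (t - s)])"
  have d: "(\<eta> has_vector_derivative v u) (at u)" if "u \<in> {s..t}" for u
  proof -
    have d\<tau>: "(\<tau> has_real_derivative 1 / (t - s)) (at u)"
      unfolding \<tau>_def using st by (auto intro!: derivative_eq_intros)
    show ?thesis
      unfolding \<eta>_def v_def
    proof (rule has_vector_derivative_vector_3)
      show "((\<lambda>u. x (\<tau> u)) has_real_derivative (q\<^sub>1 - p\<^sub>1) / (t - s)) (at u)"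
        unfolding x_def by (auto intro!: derivative_eq_intros d\<tau>)
      show "((\<lambda>u. y (\<tau> u)) has_real_derivative (q\<^sub>2 - p\<^sub>2) / (t - s)) (at u)"
        unfolding y_def by (auto intro!: derivative_eq_intros d\<tau>)
      have "((\<lambda>u. G (\<tau> u)) has_real_derivative f (\<tau> u) * (1 / (t - s))) (at u)"
        by (rule DERIV_chain2[OF G' d\<tau>]) (use \<tau> that in auto)
      then show "((\<lambda>u. z + (G (\<tau> u) - G 0)) has_real_derivative f (\<tau> u) / (t - s)) (at u)"
        by (auto intro!: derivative_eq_intros)
    qed
  qed
  have "continuous_on {s..t} v"
  proof -
    have "continuous_on {s..t} (\<lambda>u. f (\<tau> u))"
      unfolding \<tau>_def using st by (intro continuous_on_compose2[OF contf[of UNIV]] continuous_intros) auto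
    then show ?thesis
      unfolding v_def using st by (intro continuous_on_vector_3 continuous_intros) auto
  qed
  then have "bounded (v ` {s..t})"
    by (intro compact_imp_bounded compact_continuous_image) auto
  then obtain C where C: "C > 0" "\<And>u. u \<in> {s..t} \<Longrightarrow> norm (v u) \<le> C"
    by (auto simp: bounded_pos)
  have lip: "C-lipschitz_on {s..t} \<eta>"
  proof (rule bounded_derivative_imp_lipschitz)
    show "(\<eta> has_derivative (\<lambda>h. h *\<^sub>R v u)) (at u within {s..t})" if "u \<in> {s..t}" for u
      using d[OF that] by (auto simp: has_vector_derivative_def intro: has_derivative_at_withinI)
    show "onorm (\<lambda>h. h *\<^sub>R v u) \<le> C" if "u \<in> {s..t}" for u
      using C(2)[OF that] by (intro onorm_le) (simp add: mult.commute[of C] mult_left_mono)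
  qed (use C in auto)
  have mfd: "\<eta> u \<in> sr_manifold" if "u \<in> {s..t}" for u
    using interpolation_in_convex[OF _ box(1,2) \<tau>[OF that]]
      interpolation_in_convex[OF _ box(3,4) \<tau>[OF that]]
    by (simp add: \<eta>_def x_def y_def sr_manifold_def)
  have dist: "v u \<in> distribution b (\<eta> u)" for u
    by (simp add: distribution_frame v_def \<eta>_def X1_def X2_def f_def vec_eq_iff forall_3)
  have metric: "sqrt (sr_metric a \<alpha> (\<eta> u) (v u) (v u)) \<le> l / (t - s)" if "u \<in> {s..t}" for u
  proof (rule real_le_lsqrt)
    show "sr_metric a \<alpha> (\<eta> u) (v u) (v u) \<le> (l / (t - s))\<^sup>2"
      using divide_right_mono[OF speed[OF \<tau>[OF that]], of "(t - s)\<^sup>2"] st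
      by (simp add: sr_metric_def v_def \<eta>_def x_def y_def power_divide add_divide_distrib
          power2_eq_square)
  qed (use l st in auto)
  have int: "((\<lambda>u. l / (t - s)) has_integral l) {s..t}"
    using has_integral_const_real[of "l / (t - s)" s t] st by simp
  have "sr_path a b \<alpha> s t \<eta> l"
    unfolding sr_path_def
  proof (intro conjI exI[of _ "\<lambda>u. l / (t - s)"] exI[of _ "{}"] ballI)
    show "\<exists>C. C-lipschitz_on {s..t} \<eta>" using lip by blast
    show "\<exists>w. (\<eta> has_vector_derivative w) (at u) \<and> w \<in> distribution b (\<eta> u) \<and>
        sqrt (sr_metric a \<alpha> (\<eta> u) w w) \<le> l / (t - s)" if "u \<in> {s<..<t} - {}" for u
      using that by (intro exI[of _ "v u"] conjI d dist metric) auto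
  qed (use l st mfd int in auto)
  moreover have "\<eta> s = vector [p\<^sub>1, p\<^sub>2, z]" "\<eta> t = vector [q\<^sub>1, q\<^sub>2, z + drift b p\<^sub>1 p\<^sub>2 q\<^sub>1 q\<^sub>2]"
    using st G1 by (simp_all add: \<eta>_def \<tau>_def x_def y_def)
  ultimately show "\<exists>\<eta>. sr_path a b \<alpha> s t \<eta> l \<and> \<eta> s = vector [p\<^sub>1, p\<^sub>2, z] \<and>
      \<eta> t = vector [q\<^sub>1, q\<^sub>2, z + drift b p\<^sub>1 p\<^sub>2 q\<^sub>1 q\<^sub>2]"
    by blast
qed

lemma drift_horizontal: "drift b p c q c = 0"
  by (simp add: drift_def)

lemma drift_vertical: "drift b w p w q = w\<^sup>2 * drift b 1 p 1 q"
  by (simp add: drift_def)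

lemma drift_axis: "drift b 0 p 0 q = 0"
  by (simp add: drift_vertical[of b 0])

lemma drift_bounds:
  assumes "p\<^sub>1 \<in> {0..H}" "q\<^sub>1 \<in> {0..H}" "0 \<le> p\<^sub>2" "p\<^sub>2 \<le> q\<^sub>2" "q\<^sub>2 \<le> Y"
  shows "0 \<le> drift b p\<^sub>1 p\<^sub>2 q\<^sub>1 q\<^sub>2" "drift b p\<^sub>1 p\<^sub>2 q\<^sub>1 q\<^sub>2 \<le> (q\<^sub>2 - p\<^sub>2) * (H\<^sup>2 * Y ^ b)"
proof -
  let ?f = "\<lambda>\<tau>. (p\<^sub>1 + \<tau> * (q\<^sub>1 - p\<^sub>1))\<^sup>2 * (p\<^sub>2 + \<tau> * (q\<^sub>2 - p\<^sub>2)) ^ b"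
  have int: "?f integrable_on {0..1}"
    by (intro integrable_continuous_real continuous_intros)
  have f: "0 \<le> ?f \<tau> \<and> ?f \<tau> \<le> H\<^sup>2 * Y ^ b" if "\<tau> \<in> {0..1}" for \<tau>
  proof -
    have "p\<^sub>1 + \<tau> * (q\<^sub>1 - p\<^sub>1) \<in> {0..H}"
      by (rule interpolation_in_convex) (use assms that in auto)
    moreover have "p\<^sub>2 + \<tau> * (q\<^sub>2 - p\<^sub>2) \<in> {0..Y}"
      by (rule interpolation_in_convex) (use assms that in auto)
    ultimately show ?thesis by (intro conjI mult_mono power_mono mult_nonneg_nonneg) auto
  qed
  have "0 \<le> integral {0..1} ?f"
    using f by (intro integral_nonneg[OF int]) auto
  moreover have "integral {0..1} ?f \<le> integral {0..1} (\<lambda>\<tau>::real. H\<^sup>2 * Y ^ b)"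
    using f by (intro integral_le[OF int]) auto
  ultimately show "0 \<le> drift b p\<^sub>1 p\<^sub>2 q\<^sub>1 q\<^sub>2" "drift b p\<^sub>1 p\<^sub>2 q\<^sub>1 q\<^sub>2 \<le> (q\<^sub>2 - p\<^sub>2) * (H\<^sup>2 * Y ^ b)"
    using assms unfolding drift_def by (auto intro!: mult_left_mono)
qed

text \<open>The height that the loop removes is at least linear in \<open>k\<close>: the lower bound \<open>m\<close> for \<open>x\<^sub>2\<close>
  can be kept away from \<open>0\<close> when \<open>k\<close> becomes small.\<close>

lemma drift_descent:
  assumes "0 \<le> m" "m \<le> r - k" "0 \<le> k"
  shows "drift b 1 r 1 (r - k) \<le> - (k * m ^ b)"
proof -
  let ?f = "\<lambda>\<tau>. (r - \<tau> * k) ^ b"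
  have int: "?f integrable_on {0..1}"
    by (intro integrable_continuous_real continuous_intros)
  have "m ^ b \<le> ?f \<tau>" if "\<tau> \<in> {0..1}" for \<tau>
    using interpolation_in_convex[of "{m..}" r "r - k" \<tau>] that assms
    by (intro power_mono) auto
  then have "integral {0..1} (\<lambda>\<tau>::real. m ^ b) \<le> integral {0..1} ?f"
    using integral_le[OF _ int, of "\<lambda>_. m ^ b"] by auto
  then have "k * m ^ b \<le> k * integral {0..1} ?f"
    using assms by (intro mult_left_mono) auto
  then show ?thesis by (simp add: drift_def)
qed

section \<open>Competitors for the constant weight 1\<close>

abbreviation "reach a b \<equiv> joinable a b (\<lambda>_. 1)"

text \<open>In the quadrant \<open>x\<^sub>1, x\<^sub>2 \<ge> 0\<close> the metric is dominated by the Euclidean metric of the plane, so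
  the Euclidean length bounds the length of the lift.\<close>

lemma reach_segment:
  assumes "p\<^sub>1 \<in> {0..<1/2}" "q\<^sub>1 \<in> {0..<1/2}" "p\<^sub>2 \<in> {0..<1}" "q\<^sub>2 \<in> {0..<1}"
    and "(q\<^sub>1 - p\<^sub>1)\<^sup>2 + (q\<^sub>2 - p\<^sub>2)\<^sup>2 \<le> l\<^sup>2" "l \<ge> 0"
  shows "reach a b (vector [p\<^sub>1, p\<^sub>2, z]) (vector [q\<^sub>1, q\<^sub>2, z + drift b p\<^sub>1 p\<^sub>2 q\<^sub>1 q\<^sub>2]) l"
proof (rule joinable_segment)
  fix \<tau> :: real assume \<tau>: "\<tau> \<in> {0..1}"
  let ?c = "1 * (p\<^sub>1 + \<tau> * (q\<^sub>1 - p\<^sub>1)) * (p\<^sub>2 + \<tau> * (q\<^sub>2 - p\<^sub>2)) ^ a"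
  have "0 \<le> ?c"
    using interpolation_in_convex[of "{0..}" p\<^sub>1 q\<^sub>1 \<tau>] interpolation_in_convex[of "{0..}" p\<^sub>2 q\<^sub>2 \<tau>]
      \<tau> assms by auto
  then have "(1 - ?c) * (q\<^sub>2 - p\<^sub>2)\<^sup>2 \<le> (q\<^sub>2 - p\<^sub>2)\<^sup>2"
    using mult_right_mono[of "1 - ?c" 1 "(q\<^sub>2 - p\<^sub>2)\<^sup>2"] by simp
  then show "(q\<^sub>1 - p\<^sub>1)\<^sup>2 + (1 - ?c) * (q\<^sub>2 - p\<^sub>2)\<^sup>2 \<le> l\<^sup>2"
    using assms(5) by linarith
qed (use assms(1-4,6) in auto)

lemma reach_axis:
  assumes "0 \<le> p" "p \<le> q" "q < 1"
  shows "reach a b (vector [0, p, z]) (vector [0, q, z]) (q - p)"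
  using reach_segment[of 0 0 p q "q - p" a b z] assms by (simp add: drift_axis)

text \<open>On a bump of slope \<open>s\<close>, whose plateau is at \<open>x\<^sub>1 = h = s \<epsilon>\<close>, the slopes lose at most
  \<open>\<epsilon> s\<^sup>2\<close> altogether and the plateau gains at least \<open>s \<epsilon>\<^bsup>a+2\<^esup> / 2\<close>. The choice \<open>s = \<epsilon>\<^bsup>a+1\<^esup> / 4\<close> maximizes the difference.\<close>

lemma reach_bump:
  fixes \<epsilon> :: real
  assumes \<epsilon>: "0 < \<epsilon>" "3 * \<epsilon> < 1"
  shows "\<exists>D. 0 \<le> D \<and> D \<le> 3 ^ (b + 1) * \<epsilon> ^ (2 * a + b + 5) / 16 \<and>
    reach a b (vector [0, 0, 0]) (vector [0, 3 * \<epsilon>, D]) (3 * \<epsilon> - \<epsilon> ^ (2 * a + 3) / 16)"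
proof -
  define s where "s = \<epsilon> ^ (a + 1) / 4"
  define h where "h = s * \<epsilon>"
  have pow: "0 < \<epsilon> ^ n" "\<epsilon> ^ n \<le> 1" for n
    using \<epsilon> by (auto intro: power_le_one)
  have s: "0 < s" "s \<le> 1/4" unfolding s_def using pow[of "a + 1"] by auto
  have h: "0 < h" "h < 1/2"
    unfolding h_def using s \<epsilon> mult_mono[of s "1/4" \<epsilon> 1] by auto
  define D\<^sub>1 where "D\<^sub>1 = drift b 0 0 h \<epsilon>"
  define D\<^sub>2 where "D\<^sub>2 = drift b h \<epsilon> h (2 * \<epsilon>)"
  define D\<^sub>3 where "D\<^sub>3 = drift b h (2 * \<epsilon>) 0 (3 * \<epsilon>)"
  have slope: "h\<^sup>2 + \<epsilon>\<^sup>2 \<le> (\<epsilon> * (1 + s\<^sup>2 / 2))\<^sup>2"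
    unfolding h_def using \<epsilon> s by (simp add: power2_eq_square algebra_simps)
  have 1: "reach a b (vector [0, 0, 0]) (vector [h, \<epsilon>, D\<^sub>1]) (\<epsilon> * (1 + s\<^sup>2 / 2))"
    using reach_segment[of 0 h 0 \<epsilon> "\<epsilon> * (1 + s\<^sup>2 / 2)" a b 0] h \<epsilon> slope by (simp add: D\<^sub>1_def)
  have 3: "reach a b (vector [h, 2 * \<epsilon>, D\<^sub>1 + D\<^sub>2]) (vector [0, 3 * \<epsilon>, D\<^sub>1 + D\<^sub>2 + D\<^sub>3])
      (\<epsilon> * (1 + s\<^sup>2 / 2))"
    using reach_segment[of h 0 "2 * \<epsilon>" "3 * \<epsilon>" "\<epsilon> * (1 + s\<^sup>2 / 2)" a b "D\<^sub>1 + D\<^sub>2"] h \<epsilon> slope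
    by (simp add: D\<^sub>3_def)
  have he: "0 \<le> h * \<epsilon> ^ a" "h * \<epsilon> ^ a \<le> 1"
    using h pow[of a] mult_mono[of h 1 "\<epsilon> ^ a" 1] by auto
  have 2: "reach a b (vector [h, \<epsilon>, D\<^sub>1]) (vector [h, 2 * \<epsilon>, D\<^sub>1 + D\<^sub>2]) (\<epsilon> * (1 - h * \<epsilon> ^ a / 2))"
    unfolding D\<^sub>2_def
  proof (rule joinable_segment)
    fix \<tau> :: real assume \<tau>: "\<tau> \<in> {0..1}"
    let ?y = "\<epsilon> + \<tau> * (2 * \<epsilon> - \<epsilon>)"
    have "\<epsilon> ^ a \<le> ?y ^ a"
      using \<tau> \<epsilon> by (intro power_mono) auto
    then have "1 - h * ?y ^ a \<le> 1 - h * \<epsilon> ^ a"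
      using h by (simp add: mult_left_mono)
    also have "\<dots> \<le> (1 - h * \<epsilon> ^ a / 2)\<^sup>2"
      using zero_le_power2[of "h * \<epsilon> ^ a"] by (simp add: power2_diff power_divide)
    finally have "(1 - h * ?y ^ a) * \<epsilon>\<^sup>2 \<le> (1 - h * \<epsilon> ^ a / 2)\<^sup>2 * \<epsilon>\<^sup>2"
      by (rule mult_right_mono) simp
    then show "(h - h)\<^sup>2 + (1 - 1 * (h + \<tau> * (h - h)) * ?y ^ a) * (2 * \<epsilon> - \<epsilon>)\<^sup>2
        \<le> (\<epsilon> * (1 - h * \<epsilon> ^ a / 2))\<^sup>2"
      by (simp add: power_mult_distrib mult.commute)
  qed (use h \<epsilon> he in auto)
  have len: "\<epsilon> * (1 + s\<^sup>2 / 2) + \<epsilon> * (1 - h * \<epsilon> ^ a / 2) + \<epsilon> * (1 + s\<^sup>2 / 2)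
      = 3 * \<epsilon> - \<epsilon> ^ (2 * a + 3) / 16"
    by (simp add: h_def s_def field_simps power2_eq_square power_add power_mult
        numeral_3_eq_3)
  have "0 \<le> D\<^sub>i \<and> D\<^sub>i \<le> \<epsilon> * (h\<^sup>2 * (3 * \<epsilon>) ^ b)" if "D\<^sub>i \<in> {D\<^sub>1, D\<^sub>2, D\<^sub>3}" for D\<^sub>i
    using that h \<epsilon> drift_bounds[of 0 h h 0 \<epsilon> "3 * \<epsilon>" b] drift_bounds[of h h h \<epsilon> "2 * \<epsilon>" "3 * \<epsilon>" b]
      drift_bounds[of h h 0 "2 * \<epsilon>" "3 * \<epsilon>" "3 * \<epsilon>" b]
    by (auto simp: D\<^sub>1_def D\<^sub>2_def D\<^sub>3_def)
  from this[of D\<^sub>1] this[of D\<^sub>2] this[of D\<^sub>3]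
  have D: "0 \<le> D\<^sub>1 + D\<^sub>2 + D\<^sub>3" "D\<^sub>1 + D\<^sub>2 + D\<^sub>3 \<le> 3 * (\<epsilon> * (h\<^sup>2 * (3 * \<epsilon>) ^ b))"
    by auto
  have "3 * (\<epsilon> * (h\<^sup>2 * (3 * \<epsilon>) ^ b)) = 3 ^ (b + 1) * \<epsilon> ^ (2 * a + b + 5) / 16"
    by (simp add: h_def s_def field_simps power2_eq_square power_add eval_nat_numeral mult_2)
  then have "D\<^sub>1 + D\<^sub>2 + D\<^sub>3 \<le> 3 ^ (b + 1) * \<epsilon> ^ (2 * a + b + 5) / 16"
    using D(2) by (simp only:)
  then show ?thesis
    using D(1) joinable_trans[OF joinable_trans[OF 1 2] 3, unfolded len] by blast
qed

text \<open>Of the four sides of the rectangle only the descending one, on the line \<open>x\<^sub>1 = w\<close>, changes \<open>x\<^sub>3\<close>: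
  the form \<open>x\<^sub>1\<^sup>2 x\<^sub>2\<^sup>b dx\<^sub>2\<close> vanishes where \<open>x\<^sub>2\<close> is constant and on the axis \<open>x\<^sub>1 = 0\<close>. Descending there
  and climbing back on the axis is what makes the change negative.\<close>

lemma reach_loop:
  assumes "0 \<le> k" "k \<le> r" "r < 1" "0 \<le> w" "w < 1/2"
  shows "reach a b (vector [0, r, z]) (vector [0, r, z + w\<^sup>2 * drift b 1 r 1 (r - k)]) (2 * w + 2 * k)"
proof -
  let ?z = "z + w\<^sup>2 * drift b 1 r 1 (r - k)"
  have "reach a b (vector [0, r, z]) (vector [w, r, z]) w"
    using reach_segment[of 0 w r r w a b z] assms by (simp add: drift_horizontal)
  also have "reach a b (vector [w, r, z]) (vector [w, r - k, ?z]) k"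
    using reach_segment[of w w r "r - k" k a b z] assms by (simp add: drift_vertical[of b w])
  also have "reach a b (vector [w, r - k, ?z]) (vector [0, r - k, ?z]) w"
    using reach_segment[of w 0 "r - k" "r - k" w a b ?z] assms by (simp add: drift_horizontal)
  also have "reach a b (vector [0, r - k, ?z]) (vector [0, r, ?z]) k"
    using reach_axis[of "r - k" r a b ?z] assms by simp
  finally show ?thesis by (simp add: algebra_simps)
qed

text \<open>With \<open>k = \<epsilon>\<^bsup>2a+3\<^esup> / 128\<close> the bump saves \<open>8 k\<close>, whereas the loop costs \<open>2 w + 2 k\<close>, so it
  suffices that the width \<open>w\<close> needed to cancel the height \<open>D\<close> of the bump is less than \<open>k\<close>.\<close>

lemma reach_shortcut:
  fixes r :: real
  assumes r: "0 < r" "r < 1" and ab: "b > 4 * a + 4"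
  shows "\<exists>l<r. reach a b (vector [0, 0, 0]) (vector [0, r, 0]) l"
proof -
  \<comment> \<open>The constant in the bound \<open>w\<^sup>2 \<le> c \<epsilon> k\<^sup>2\<close> derived below; hence \<open>\<epsilon> < 1 / c\<close> is what is needed.\<close>
  define c where "c = 2 ^ 17 * 3 ^ (b + 1) * (2 / r) ^ b"
  have c: "c > 0" using r by (simp add: c_def)
  define \<epsilon> where "\<epsilon> = min (r / 4) (1 / (2 * c))"
  have \<epsilon>: "0 < \<epsilon>" "\<epsilon> \<le> r / 4" "\<epsilon> \<le> 1 / (2 * c)" using r c by (auto simp: \<epsilon>_def)
  have c\<epsilon>: "c * \<epsilon> < 1"
    using mult_left_mono[OF \<epsilon>(3), of c] c by simp
  obtain D where D: "0 \<le> D" "D \<le> 3 ^ (b + 1) * \<epsilon> ^ (2 * a + b + 5) / 16"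
    and bump: "reach a b (vector [0, 0, 0]) (vector [0, 3 * \<epsilon>, D]) (3 * \<epsilon> - \<epsilon> ^ (2 * a + 3) / 16)"
    using reach_bump[of \<epsilon> b a] \<epsilon> r by auto
  define k where "k = \<epsilon> ^ (2 * a + 3) / 128"
  have "\<epsilon> ^ (2 * a + 3) \<le> \<epsilon> ^ 1"
    using \<epsilon> r by (intro power_decreasing) auto
  then have k: "0 < k" "k \<le> r / 2" "k < 1/2"
    using \<epsilon> r by (auto simp: k_def)
  define I where "I = - drift b 1 r 1 (r - k)"
  have I: "k * (r / 2) ^ b \<le> I"
    unfolding I_def using drift_descent[of "r / 2" r k b] k r by auto
  have Ipos: "0 < k * (r / 2) ^ b" using k r by simp
  define w where "w = sqrt (D / I)"
  have DI: "0 \<le> D / I" using D I Ipos by auto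
  have "D / I \<le> (3 ^ (b + 1) * \<epsilon> ^ (2 * a + b + 5) / 16) / (k * (r / 2) ^ b)"
    using D I Ipos by (intro frac_le) auto
  also have "\<dots> = c * \<epsilon> ^ (b + 2) / 128\<^sup>2"
    using \<epsilon> r by (simp add: c_def k_def field_simps power_add power_divide eval_nat_numeral)
  \<comment> \<open>The relation between \<open>a\<close> and \<open>b\<close> leaves a factor \<open>\<epsilon>\<close> to absorb the constant \<open>c\<close>.\<close>
  also have "\<dots> \<le> c * \<epsilon> ^ (4 * a + 7) / 128\<^sup>2"
    using \<epsilon> r c ab by (intro divide_right_mono mult_left_mono power_decreasing) auto
  also have "\<dots> = c * \<epsilon> * k\<^sup>2"
    by (simp add: k_def power_divide power_add eval_nat_numeral flip: power_mult)
  also have "\<dots> < k\<^sup>2"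
    using mult_strict_right_mono[OF c\<epsilon>, of "k\<^sup>2"] k by simp
  finally have "w < k"
    unfolding w_def using k by (intro real_less_lsqrt) auto
  have "D + w\<^sup>2 * drift b 1 r 1 (r - k) = 0"
  proof -
    have "w\<^sup>2 * I = D" using DI I Ipos by (simp add: w_def)
    then show ?thesis by (simp add: I_def)
  qed
  then have loop: "reach a b (vector [0, r, D]) (vector [0, r, 0]) (2 * w + 2 * k)"
    using reach_loop[of k r w a b D] DI k r \<open>w < k\<close> by (simp add: w_def)
  have straight: "reach a b (vector [0, 3 * \<epsilon>, D]) (vector [0, r, D]) (r - 3 * \<epsilon>)"
    using \<epsilon> r by (intro reach_axis) auto
  have "3 * \<epsilon> - \<epsilon> ^ (2 * a + 3) / 16 + (r - 3 * \<epsilon>) + (2 * w + 2 * k) < r"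
    using \<open>w < k\<close> k by (simp add: k_def)
  then show ?thesis
    using joinable_trans[OF joinable_trans[OF bump straight] loop] by blast
qed

theorem theorem1p2:
  fixes a b :: nat and \<gamma> :: "real \<Rightarrow> real^3"
  assumes "a \<ge> 1" and "b \<ge> 1"
    and "\<gamma> = (\<lambda>t. vector [0, t, 0])"
    and "b > 4 * a + 4"
  shows "\<not> locally_geodesic_on a b (\<lambda>_. 1) {-1<..<1} \<gamma>"
proof
  assume "locally_geodesic_on a b (\<lambda>_. 1) {-1<..<1} \<gamma>"
  then obtain J where J: "0 \<in> J" "openin (top_of_set {-1<..<1}) J"
    and geo: "geodesic_on a b (\<lambda>_. 1) J \<gamma>"
    unfolding locally_geodesic_on_def
    by (metis greaterThanLessThan_iff less_numeral_extra(1) neg_less_0_iff_less)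
  from J(2) have "open J" by (simp add: openin_open_eq)
  then obtain e where e: "e > 0" "ball 0 e \<subseteq> J"
    using J(1) open_contains_ball by blast
  define r where "r = min (e / 2) (1 / 2)"
  have r: "0 < r" "r < 1" "r \<in> J"
    using e by (auto simp: r_def subset_iff)
  obtain l where l: "l < r" "reach a b (vector [0, 0, 0]) (vector [0, r, 0]) l"
    using reach_shortcut[OF r(1,2) assms(4)] by blast
  have "sr_dist a b (\<lambda>_. 1) (\<gamma> 0) (\<gamma> r) = ennreal r"
    using geo J(1) r unfolding geodesic_on_def by auto
  moreover have "sr_dist a b (\<lambda>_. 1) (\<gamma> 0) (\<gamma> r) \<le> ennreal l"
    using sr_dist_le_joinable[OF l(2)] assms(3) by simp
  ultimately show False
    using l(1) r(1) by (metis ennreal_lessI leD)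
qed

end
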